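(* Let $n\ge1$, let $f:\mathbb{R}^n\to\mathbb{R}^n$ be continuous, let $\mathcal{B}\subset\mathbb{R}^n$ be a box, let $V:\mathbb{R}^n\to\mathbb{R}$ and $c\in\mathbb{R}$, and suppose that the set $\mathcal{X}:=\{x: V(x)<c\}\cap\mathcal{B}$ is open, connected, and forward invariant for the system $x_{k+1}=f(x_k)$. Let $\mu>0$ and let $M:\mathbb{R}^n\to\mathbb{S}^{n\times n}_{++}$ be a function that is uniformly continuous on $\mathcal{X}$ and satisfies $\mu I\preceq M(x)$ for all $x\in\mathcal{X}$. Let $\rho\in(0,1)$ and define $$G(x,\delta):=(f(x)-f(x+\delta))^\top M(f(x))\,(f(x)-f(x+\delta))-\rho^2\,\delta^\top M(x)\,\delta .$$ Let $\epsilon>0$ and suppose that for every $(x,\delta)\in\mathcal{B}\times B(0;\epsilon)$, $$\bigl(-G(x,\delta)\ge0\bigr)\ \vee\ \bigl(x+\delta\notin\mathcal{B}\bigr)\ \vee\ \bigl(V(x)\ge c\bigr)\ \vee\ \bigl(V(x+\delta)\ge c\bigr).$$ Then the system $x_{k+1}=f(x_k)$ is contracting on $\mathcal{X}$ with the metric $d(x,y)=\inf_{\gamma\in\Gamma_{x,y}}L(\gamma)$ (defined in the context) and contraction rate $\rho'$ for every $\rho'\in(\rho,1)$; that is, $d$ is a metric on $\mathcal{X}$ and $d(f(x),f(y))\le\rho'\,d(x,y)$ for all $x,y\in\mathcal{X}$ and all $\rho'\in(\rho,1)$.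
   Context: $\mathbb{S}^{n\times n}_{++}$ is the set of real symmetric positive definite $n\times n$ matrices; $A\preceq B$ means that $B-A$ is positive semidefinite. A box is a product of bounded intervals. $B(0;\epsilon)=\{\delta\in\mathbb{R}^n:\|\delta\|_\infty\le\epsilon\}$. Forward invariance of $\mathcal{X}$ means $f(\mathcal{X})\subseteq\mathcal{X}$. A metric on $\mathcal{X}$ is a function $d:\mathcal{X}\times\mathcal{X}\to\mathbb{R}_{\ge 0}$ satisfying the usual metric axioms. Contracting: the system $x_{k+1}=f(x_k)$ is contracting on a forward invariant set $\mathcal{X}$ with metric $d$ and contraction rate $\rho'\in(0,1)$ if $d(f(x),f(y))\le\rho' d(x,y)$ for all $x,y\in\mathcal{X}$. Admissible curves: for nonnegative reals $a\le b$, $\Gamma_{a,b}$ is the set of maps $\gamma:[a,b]\to\mathcal{X}$ that are continuous and piecewise regular, where piecewise regular means that $[a,b]$ can be divided into finitely many closed subintervals such that on each of them $\gamma$ is $C^1$ (one-sided derivatives at endpoints) and $\|\gamma'(t)\|\ne 0$ for all $t$. A curve on a degenerate interval $a=b$ is (vacuously) admissible and has length $0$. For $x,y\in\mathcal{X}$, $\Gamma_{x,y}:=\bigcup_{0\le a\le b}\{\gamma\in\Gamma_{a,b}:\gamma(a)=x,\ \gamma(b)=y\}$. Length of an admissible curve $\gamma:[a,b]\to\mathcal{X}$ under $M$: $L(\gamma):=\int_a^b\sqrt{\gamma'(t)^\top M(\gamma(t))\gamma'(t)}\,dt$. *)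

theory Defs
  imports "HOL-Analysis.Analysis"
begin

definition pos_definite :: "real^'n^'n \<Rightarrow> bool" where
  "pos_definite A \<longleftrightarrow> transpose A = A \<and> (\<forall>v. v \<noteq> 0 \<longrightarrow> 0 < v \<bullet> (A *v v))"

definition pos_semidefinite :: "real^'n^'n \<Rightarrow> bool" where
  "pos_semidefinite A \<longleftrightarrow> transpose A = A \<and> (\<forall>v. 0 \<le> v \<bullet> (A *v v))"

definition loewner_le :: "real^'n^'n \<Rightarrow> real^'n^'n \<Rightarrow> bool"  (infix \<open>\<preceq>\<^sub>L\<close> 50) where
  "A \<preceq>\<^sub>L B \<longleftrightarrow> pos_semidefinite (B - A)"

text \<open>The factors may be open, closed or half-open, unlike for the library's \<^const>\<open>box\<close>
  and \<^const>\<open>cbox\<close>.\<close>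
definition is_box :: "(real^'n) set \<Rightarrow> bool" where
  "is_box B \<longleftrightarrow>
    (\<exists>I :: 'n \<Rightarrow> real set. (\<forall>i. is_interval (I i) \<and> bounded (I i)) \<and> B = {x. \<forall>i. x $ i \<in> I i})"

definition inf_ball :: "real \<Rightarrow> (real^'n) set" where
  "inf_ball \<epsilon> = {\<delta>. infnorm \<delta> \<le> \<epsilon>}"

definition regular_on :: "real set \<Rightarrow> (real \<Rightarrow> real^'n) \<Rightarrow> bool" where
  "regular_on S \<gamma> \<longleftrightarrow>
    (\<exists>D. continuous_on S D \<and>
         (\<forall>t\<in>S. (\<gamma> has_vector_derivative D t) (at t within S) \<and> norm (D t) \<noteq> 0))"

text \<open>The library's \<^const>\<open>piecewise_C1_differentiable_on\<close> does not require one-sided derivatives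
  at the break points.  The partition \<open>a = p 0 < \<dots> < p k = b\<close> is strict, so \<open>a = b\<close> forces \<open>k = 0\<close>
  and the condition is then vacuous.\<close>
definition piecewise_regular_on :: "real \<Rightarrow> real \<Rightarrow> (real \<Rightarrow> real^'n) \<Rightarrow> bool" where
  "piecewise_regular_on a b \<gamma> \<longleftrightarrow>
    (\<exists>(k::nat) (p :: nat \<Rightarrow> real). p 0 = a \<and> p k = b \<and>
       (\<forall>i<k. p i < p (Suc i) \<and> regular_on {p i..p (Suc i)} \<gamma>))"

definition admissible_curve :: "(real^'n) set \<Rightarrow> real \<Rightarrow> real \<Rightarrow> (real \<Rightarrow> real^'n) \<Rightarrow> bool" where
  "admissible_curve X a b \<gamma> \<longleftrightarrow>
    \<gamma> ` {a..b} \<subseteq> X \<and> continuous_on {a..b} \<gamma> \<and> piecewise_regular_on a b \<gamma>"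

text \<open>A curve is recorded together with its parameter interval, since functions are total.\<close>
definition curves_between ::
    "(real^'n) set \<Rightarrow> real^'n \<Rightarrow> real^'n \<Rightarrow> (real \<times> real \<times> (real \<Rightarrow> real^'n)) set" where
  "curves_between X x y =
    {(a, b, \<gamma>). 0 \<le> a \<and> a \<le> b \<and> admissible_curve X a b \<gamma> \<and> \<gamma> a = x \<and> \<gamma> b = y}"

text \<open>At the finitely many break points the vector derivative may be unspecified, which does not
  affect the integral.\<close>
definition curve_length ::
    "(real^'n \<Rightarrow> real^'n^'n) \<Rightarrow> real \<times> real \<times> (real \<Rightarrow> real^'n) \<Rightarrow> real" where
  "curve_length M = (\<lambda>(a, b, \<gamma>).
    integral {a..b} (\<lambda>t. let v = vector_derivative \<gamma> (at t within {a..b})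
                         in sqrt (v \<bullet> (M (\<gamma> t) *v v))))"

text \<open>The distance only concerns points of \<open>X\<close>; it is set to \<open>0\<close> elsewhere because
  \<^locale>\<open>Metric_space\<close> asks for nonnegativity and symmetry on the whole type.\<close>
definition path_dist ::
    "(real^'n) set \<Rightarrow> (real^'n \<Rightarrow> real^'n^'n) \<Rightarrow> real^'n \<Rightarrow> real^'n \<Rightarrow> real" where
  "path_dist X M x y =
    (if x \<in> X \<and> y \<in> X then INF \<gamma>\<in>curves_between X x y. curve_length M \<gamma> else 0)"

definition forward_invariant :: "('a \<Rightarrow> 'a) \<Rightarrow> 'a set \<Rightarrow> bool" where
  "forward_invariant f X \<longleftrightarrow> f ` X \<subseteq> X"

definition contracting :: "('a \<Rightarrow> 'a) \<Rightarrow> 'a set \<Rightarrow> ('a \<Rightarrow> 'a \<Rightarrow> real) \<Rightarrow> real \<Rightarrow> bool" where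
  "contracting f X d r \<longleftrightarrow>
    forward_invariant f X \<and> Metric_space X d \<and> 0 < r \<and> r < 1 \<and>
    (\<forall>x\<in>X. \<forall>y\<in>X. d (f x) (f y) \<le> r * d x y)"

definition contraction_defect ::
    "(real^'n \<Rightarrow> real^'n) \<Rightarrow> (real^'n \<Rightarrow> real^'n^'n) \<Rightarrow> real \<Rightarrow> real^'n \<Rightarrow> real^'n \<Rightarrow> real" where
  "contraction_defect f M \<rho> x \<delta> =
    (f x - f (x + \<delta>)) \<bullet> (M (f x) *v (f x - f (x + \<delta>))) - \<rho>\<^sup>2 * (\<delta> \<bullet> (M x *v \<delta>))"

end

theory Submission
  imports Defs
begin

text \<open>The distance in question is the Riemannian distance of the metric tensor \<open>M\<close> on the open
  connected set \<open>X\<close>.  That it is a metric is classical: \<open>X\<close> is connected through polygonal paths, so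
  the infimum is over a nonempty set; curves can be reversed and concatenated; and
  \<open>\<mu> I \<preceq> M\<close> makes every curve at least \<open>sqrt \<mu>\<close> times as long as its chord, which separates points
  (\<open>Metric_space_path_dist\<close>).

  Write \<open>|v|\<^sub>A\<close> for \<open>sqrt (v \<bullet> A v)\<close>.  The hypothesis on the contraction defect says that
  \<open>|f x - f y|\<close> measured at \<open>f x\<close> is at most \<open>\<rho>\<close> times \<open>|x - y|\<close> measured at \<open>x\<close>, whenever
  \<open>x, y \<in> X\<close> are close.  The map \<open>f\<close> is only continuous, so the image of an admissible curve \<open>\<gamma>\<close> need
  not be admissible and its length cannot be estimated through the derivative of \<open>f\<close>.  Instead \<open>\<gamma>\<close>
  is cut into short arcs and the image of each arc is replaced by the straight segment between the
  images of its end points.  Because \<open>f \<circ> \<gamma>\<close> has a compact image in the open set \<open>X\<close>, these segments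
  stay in \<open>X\<close> once the arcs are short enough.

  Fix \<open>\<kappa> > 1\<close>.  Uniform continuity of \<open>M\<close> together with \<open>\<mu> I \<preceq> M\<close> gives a radius within which the
  norms attached to different points of \<open>X\<close> agree up to the factor \<open>\<kappa>\<close> (\<open>uniform_distortion\<close>).
  For a short arc from \<open>p\<close> to \<open>q\<close>, the segment from \<open>f p\<close> to \<open>f q\<close> has length at most
  \<open>\<kappa> |f q - f p|\<close>, measured at \<open>f p\<close> (\<open>path_dist_le_segment\<close>); this is at most \<open>\<kappa> \<rho> |q - p|\<close>,
  measured at \<open>p\<close>, by hypothesis; and a chord is at most \<open>\<kappa>\<close> times as long as its arc
  (\<open>chord_le_arc\<close>).  Summing over the arcs bounds the distance of the images of the end points of \<open>\<gamma>\<close>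
  by \<open>\<rho> \<kappa>\<^sup>2\<close> times the length of \<open>\<gamma>\<close> (\<open>path_dist_image_le_curve_length\<close>).  The choice
  \<open>\<kappa>\<^sup>2 = \<rho>' / \<rho>\<close> yields the rate \<open>\<rho>'\<close>; the loss of \<open>\<kappa>\<close> twice is the reason why the argument gives every
  rate above \<open>\<rho>\<close> rather than \<open>\<rho>\<close> itself.\<close>

section \<open>The norm of a positive definite matrix\<close>

definition quad_norm :: "real^'n^'n \<Rightarrow> real^'n \<Rightarrow> real" where
  "quad_norm A v = sqrt (v \<bullet> (A *v v))"

lemma pos_definite_nonneg: "pos_definite A \<Longrightarrow> 0 \<le> v \<bullet> (A *v v)"
  by (cases "v = 0") (auto simp: pos_definite_def intro: less_imp_le)

lemma quad_norm_nonneg [simp]: "pos_definite A \<Longrightarrow> 0 \<le> quad_norm A v"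
  by (simp add: quad_norm_def pos_definite_nonneg)

lemma quad_norm_square: "pos_definite A \<Longrightarrow> (quad_norm A v)\<^sup>2 = v \<bullet> (A *v v)"
  by (simp add: quad_norm_def pos_definite_nonneg)

lemma quad_norm_zero [simp]: "quad_norm A 0 = 0"
  by (simp add: quad_norm_def)

lemma quad_norm_minus [simp]: "quad_norm A (- v) = quad_norm A v"
  using matrix_vector_mult_scaleR[of A "- 1" v] by (simp add: quad_norm_def)

lemma pos_definite_symmetric:
  assumes "pos_definite A"
  shows "u \<bullet> (A *v v) = v \<bullet> (A *v u)"
  using assms unfolding pos_definite_def
  by (metis dot_lmul_matrix inner_commute matrix_vector_mul_linear transpose_matrix_vector)

lemma quad_norm_Cauchy_Schwarz:
  assumes A: "pos_definite A"
  shows "u \<bullet> (A *v v) \<le> quad_norm A u * quad_norm A v"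
proof (cases "v = 0")
  case False
  (* Positivity is used at q u - c v, which is q times the component of u that is A-orthogonal
     to v. *)
  define q where "q = v \<bullet> (A *v v)"
  define c where "c = u \<bullet> (A *v v)"
  have q: "q > 0"
    using A False by (auto simp: pos_definite_def q_def)
  have "0 \<le> (q *\<^sub>R u - c *\<^sub>R v) \<bullet> (A *v (q *\<^sub>R u - c *\<^sub>R v))"
    by (rule pos_definite_nonneg[OF A])
  also have "\<dots> = q * (q * (u \<bullet> (A *v u)) - c\<^sup>2)"
    using pos_definite_symmetric[OF A, of v u]
    by (simp add: matrix_vector_mult_diff_distrib matrix_vector_mult_scaleR inner_diff_left
        inner_diff_right c_def q_def algebra_simps power2_eq_square)
  finally have "c\<^sup>2 \<le> (quad_norm A u * quad_norm A v)\<^sup>2"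
    using q by (simp add: zero_le_mult_iff power_mult_distrib quad_norm_square[OF A] q_def mult.commute)
  then show ?thesis
    unfolding c_def by (rule power2_le_imp_le) (simp add: A)
qed simp

text \<open>The norm on matrices is the Euclidean norm of the vector of row norms, so the estimate is
  Cauchy--Schwarz in every row.\<close>
lemma norm_matrix_vector_mult_le:
  fixes A :: "real^'n^'m"
  shows "norm (A *v x) \<le> norm A * norm x"
proof -
  have "norm (A *v x) \<le> L2_set (\<lambda>i. norm (A $ i) * norm x) UNIV"
    unfolding norm_vec_def[of "A *v x"]
    by (rule L2_set_mono) (auto simp: matrix_vector_mul_component Cauchy_Schwarz_ineq2)
  also have "\<dots> = norm A * norm x"
    by (simp add: L2_set_left_distrib norm_vec_def[of A])
  finally show ?thesis .
qed

lemma bounded_bilinear_matrix_vector_mult: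
  "bounded_bilinear (\<lambda>(A :: real^'n^'m) x. A *v x)"
proof
  show "\<exists>K. \<forall>(A :: real^'n^'m) x. norm (A *v x) \<le> norm A * norm x * K"
    by (metis mult.right_neutral norm_matrix_vector_mult_le)
qed (auto simp: matrix_vector_mult_add_rdistrib matrix_vector_right_distrib
    scaleR_matrix_vector_assoc matrix_vector_mult_scaleR)

lemma continuous_on_quad_norm:
  assumes "continuous_on S A" and "continuous_on S v"
  shows "continuous_on S (\<lambda>t. quad_norm (A t) (v t))"
  unfolding quad_norm_def
  by (intro continuous_intros bounded_bilinear.continuous_on[OF bounded_bilinear_matrix_vector_mult] assms)

section \<open>Piecewise regular curves\<close>

lemma piecewise_regular_on_refl: "piecewise_regular_on a a \<gamma>"
  unfolding piecewise_regular_on_def by (intro exI[of _ 0] exI[of _ "\<lambda>_. a"]) auto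

text \<open>Statements about all admissible curves reduce to one regular arc at a time: the partition in
  the definition is consumed from left to right, with the left end point fixed.\<close>
lemma piecewise_regular_on_induct [consumes 1, case_names refl snoc]:
  assumes "piecewise_regular_on a b \<gamma>"
    and refl: "P a"
    and snoc: "\<And>b c. \<lbrakk>a \<le> b; b < c; piecewise_regular_on a b \<gamma>; regular_on {b..c} \<gamma>; P b\<rbrakk> \<Longrightarrow> P c"
  shows "P b"
proof -
  obtain k p where p: "p 0 = a" "p k = b"
    and reg: "\<And>i. i < k \<Longrightarrow> p i < p (Suc i) \<and> regular_on {p i..p (Suc i)} \<gamma>"
    using assms(1) unfolding piecewise_regular_on_def by blast
  have "a \<le> p i \<and> piecewise_regular_on a (p i) \<gamma> \<and> P (p i)" if "i \<le> k" for i
    using that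
  proof (induction i)
    case 0
    then show ?case
      using p refl by (simp add: piecewise_regular_on_refl)
  next
    case (Suc i)
    then have IH: "a \<le> p i" "piecewise_regular_on a (p i) \<gamma>" "P (p i)"
      by auto
    have "piecewise_regular_on a (p (Suc i)) \<gamma>"
      unfolding piecewise_regular_on_def
      using p reg Suc.prems by (intro exI[of _ "Suc i"] exI[of _ p]) auto
    moreover have "p i < p (Suc i)" "regular_on {p i..p (Suc i)} \<gamma>"
      using reg Suc.prems by auto
    ultimately show ?case
      using IH snoc by auto
  qed
  then show ?thesis
    using p by blast
qed

lemma piecewise_regular_on_trans:
  assumes "piecewise_regular_on a b \<gamma>" and "piecewise_regular_on b c \<gamma>"
  shows "piecewise_regular_on a c \<gamma>"
proof -
  obtain k p where p: "p 0 = a" "p k = b"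
    "\<And>i. i < k \<Longrightarrow> p i < p (Suc i) \<and> regular_on {p i..p (Suc i)} \<gamma>"
    using assms(1) unfolding piecewise_regular_on_def by blast
  obtain l q where q: "q 0 = b" "q l = c"
    "\<And>i. i < l \<Longrightarrow> q i < q (Suc i) \<and> regular_on {q i..q (Suc i)} \<gamma>"
    using assms(2) unfolding piecewise_regular_on_def by blast
  define r where "r i = (if i \<le> k then p i else q (i - k))" for i
  have rq: "r i = q (i - k)" if "k \<le> i" for i
    using that p(2) q(1) by (auto simp: r_def)
  have "r i < r (Suc i) \<and> regular_on {r i..r (Suc i)} \<gamma>" if "i < k + l" for i
  proof (cases "i < k")
    case True
    then show ?thesis
      using p(3)[OF True] by (simp add: r_def)
  next
    case False
    then show ?thesis
      using q(3)[of "i - k"] that by (simp add: rq Suc_diff_le)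
  qed
  then show ?thesis
    unfolding piecewise_regular_on_def
    using p q by (intro exI[of _ "k + l"] exI[of _ r]) (auto simp: rq, simp add: r_def)
qed

lemma regular_on_imp_piecewise:
  assumes "a < b" and "regular_on {a..b} \<gamma>"
  shows "piecewise_regular_on a b \<gamma>"
  unfolding piecewise_regular_on_def
  using assms by (intro exI[of _ 1] exI[of _ "\<lambda>i. if i = 0 then a else b"]) auto

lemma regular_on_cong:
  assumes "regular_on S \<gamma>" and "\<And>t. t \<in> S \<Longrightarrow> \<gamma>' t = \<gamma> t"
  shows "regular_on S \<gamma>'"
proof -
  obtain D where D: "continuous_on S D"
    "\<And>t. t \<in> S \<Longrightarrow> (\<gamma> has_vector_derivative D t) (at t within S) \<and> norm (D t) \<noteq> 0"
    using assms(1) unfolding regular_on_def by blast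
  then have "(\<gamma>' has_vector_derivative D t) (at t within S)" if "t \<in> S" for t
    using has_vector_derivative_transform[of t S \<gamma>' \<gamma> "D t"] assms(2) that by simp
  with D show ?thesis
    unfolding regular_on_def by (intro exI[of _ D]) simp
qed

lemma piecewise_regular_on_cong:
  assumes "piecewise_regular_on a b \<gamma>" and "\<And>t. t \<in> {a..b} \<Longrightarrow> \<gamma>' t = \<gamma> t"
  shows "piecewise_regular_on a b \<gamma>'"
  using assms
proof (induction rule: piecewise_regular_on_induct)
  case refl
  show ?case
    by (rule piecewise_regular_on_refl)
next
  case (snoc b c)
  have "regular_on {b..c} \<gamma>'"
    by (rule regular_on_cong[OF snoc.hyps(4)]) (use snoc.prems snoc.hyps in simp)
  then have "piecewise_regular_on b c \<gamma>'"
    using snoc.hyps by (simp add: regular_on_imp_piecewise)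
  moreover have "piecewise_regular_on a b \<gamma>'"
    by (rule snoc.IH) (use snoc.prems snoc.hyps in simp)
  ultimately show ?case
    by (rule piecewise_regular_on_trans[rotated])
qed

text \<open>The condition \<open>m \<noteq> 0\<close> keeps the velocity nonzero.  The values \<open>m = 1\<close> and \<open>m = -1\<close> give
  translation and reversal of curves.\<close>
lemma regular_on_affine:
  assumes "regular_on S \<gamma>" and "m \<noteq> 0" and sub: "(\<lambda>t. m * t + s) ` T \<subseteq> S"
  shows "regular_on T (\<lambda>t. \<gamma> (m * t + s))"
proof -
  obtain D where D: "continuous_on S D"
    and der: "\<And>t. t \<in> S \<Longrightarrow> (\<gamma> has_vector_derivative D t) (at t within S) \<and> norm (D t) \<noteq> 0"
    using assms(1) unfolding regular_on_def by blast
  have "((\<lambda>t. \<gamma> (m * t + s)) has_vector_derivative m *\<^sub>R D (m * t + s)) (at t within T)"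
    if "t \<in> T" for t
  proof -
    have "((\<lambda>t. m * t + s) has_vector_derivative m) (at t within T)"
      by (auto intro!: derivative_eq_intros)
    moreover have "(\<gamma> has_vector_derivative D (m * t + s))
        (at (m * t + s) within (\<lambda>t. m * t + s) ` T)"
      using der that sub by (blast intro: has_vector_derivative_within_subset)
    ultimately show ?thesis
      using vector_diff_chain_within unfolding o_def by blast
  qed
  moreover have "continuous_on T (\<lambda>t. m *\<^sub>R D (m * t + s))"
    by (intro continuous_intros continuous_on_compose2[OF D] sub)
  ultimately show ?thesis
    unfolding regular_on_def using der sub \<open>m \<noteq> 0\<close>
    by (intro exI[of _ "\<lambda>t. m *\<^sub>R D (m * t + s)"]) auto
qed

lemma piecewise_regular_on_shift:
  assumes "piecewise_regular_on a b \<gamma>"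
  shows "piecewise_regular_on (a - s) (b - s) (\<lambda>t. \<gamma> (t + s))"
  using assms
proof (induction rule: piecewise_regular_on_induct)
  case refl
  show ?case
    by (rule piecewise_regular_on_refl)
next
  case (snoc b c)
  have "regular_on {b - s..c - s} (\<lambda>t. \<gamma> (t + s))"
    using regular_on_affine[OF snoc.hyps(4), of 1 s "{b - s..c - s}"] by auto
  then show ?case
    using snoc piecewise_regular_on_trans[OF snoc.IH regular_on_imp_piecewise] by simp
qed

lemma piecewise_regular_on_reflect:
  assumes "piecewise_regular_on a b \<gamma>"
  shows "piecewise_regular_on (s - b) (s - a) (\<lambda>t. \<gamma> (s - t))"
  using assms
proof (induction rule: piecewise_regular_on_induct)
  case refl
  show ?case
    by (rule piecewise_regular_on_refl)
next
  case (snoc b c)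
  have "regular_on {s - c..s - b} (\<lambda>t. \<gamma> (s - t))"
    using regular_on_affine[OF snoc.hyps(4), of "-1" s "{s - c..s - b}"] by auto
  then show ?case
    using snoc piecewise_regular_on_trans[OF regular_on_imp_piecewise snoc.IH] by simp
qed

lemma regular_on_has_vector_derivative_interior:
  assumes D: "\<And>t. t \<in> {a..b} \<Longrightarrow> (\<gamma> has_vector_derivative D t) (at t within {a..b})"
    and t: "t \<in> {a<..<b}"
  shows "(\<gamma> has_vector_derivative D t) (at t)"
  using D[of t] t at_within_interior[of t "{a..b}"] by simp

text \<open>With the exceptional points collected in one finite set, the velocity can be taken to be the
  two-sided derivative: finite sets do not matter for integrals, nor for the fundamental theorem of
  calculus applied to a continuous curve.\<close>
lemma piecewise_regular_on_differentiable:
  assumes "piecewise_regular_on a b \<gamma>"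
  shows "\<exists>S. finite S \<and> (\<forall>t\<in>{a..b} - S. (\<gamma> has_vector_derivative vector_derivative \<gamma> (at t)) (at t))"
  using assms
proof (induction rule: piecewise_regular_on_induct)
  case refl
  show ?case
    by (rule exI[of _ "{a}"]) auto
next
  case (snoc b c)
  then obtain S where S: "finite S"
    "\<And>t. t \<in> {a..b} - S \<Longrightarrow> (\<gamma> has_vector_derivative vector_derivative \<gamma> (at t)) (at t)"
    by blast
  obtain D where "\<And>t. t \<in> {b..c} \<Longrightarrow> (\<gamma> has_vector_derivative D t) (at t within {b..c})"
    using snoc.hyps unfolding regular_on_def by blast
  then have bc: "(\<gamma> has_vector_derivative vector_derivative \<gamma> (at t)) (at t)" if "t \<in> {b<..<c}" for t
    using that regular_on_has_vector_derivative_interior[of b c \<gamma> D t]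
    by (metis vector_derivative_at)
  have "(\<gamma> has_vector_derivative vector_derivative \<gamma> (at t)) (at t)"
    if "t \<in> {a..c} - (S \<union> {b, c})" for t
    using that S(2)[of t] bc[of t] by (cases "t \<le> b") auto
  with S(1) show ?case
    by (intro exI[of _ "S \<union> {b, c}"]) simp
qed

section \<open>Arc length\<close>

definition speed :: "(real^'n \<Rightarrow> real^'n^'n) \<Rightarrow> (real \<Rightarrow> real^'n) \<Rightarrow> real \<Rightarrow> real" where
  "speed M \<gamma> t = quad_norm (M (\<gamma> t)) (vector_derivative \<gamma> (at t))"

text \<open>This holds for arbitrary functions: the derivatives within \<open>{a..b}\<close> and at the point can
  only differ at \<open>a\<close> and \<open>b\<close>.  The integrand on the right does not depend on the parameter interval,
  which is what makes length additive.\<close>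
lemma curve_length_eq_integral_speed:
  "curve_length M (a, b, \<gamma>) = integral {a..b} (speed M \<gamma>)"
  unfolding curve_length_def split
proof (rule integral_spike[of "{a, b}"])
  fix t assume "t \<in> {a..b} - {a, b}"
  then have "at t within {a..b} = at t"
    using at_within_interior[of t "{a..b}"] by simp
  then show "speed M \<gamma> t = (let v = vector_derivative \<gamma> (at t within {a..b})
      in sqrt (v \<bullet> (M (\<gamma> t) *v v)))"
    by (simp add: speed_def quad_norm_def Let_def)
qed (simp add: negligible_finite)

text \<open>On each regular arc the speed agrees, except at the end points, with the continuous function
  obtained from the one-sided derivatives.\<close>
lemma speed_integrable:
  assumes pw: "piecewise_regular_on a b \<gamma>" and cont: "continuous_on {a..b} (\<lambda>t. M (\<gamma> t))"
  shows "speed M \<gamma> integrable_on {a..b}"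
  using assms
proof (induction rule: piecewise_regular_on_induct)
  case refl
  show ?case
    using integrable_on_refl[of "speed M \<gamma>" a] by simp
next
  case (snoc b c)
  obtain D where contD: "continuous_on {b..c} D"
    and D: "\<And>t. t \<in> {b..c} \<Longrightarrow> (\<gamma> has_vector_derivative D t) (at t within {b..c})"
    using snoc.hyps unfolding regular_on_def by blast
  have ab: "speed M \<gamma> integrable_on {a..b}"
    using snoc.IH snoc.hyps continuous_on_subset[OF snoc.prems, of "{a..b}"] by simp
  have "speed M \<gamma> integrable_on {b..c}"
  proof (rule integrable_spike_finite[of "{b, c}"])
    show "(\<lambda>t. quad_norm (M (\<gamma> t)) (D t)) integrable_on {b..c}"
      using snoc.hyps
      by (intro integrable_continuous_real continuous_on_quad_norm contD
          continuous_on_subset[OF snoc.prems]) auto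
    fix t assume "t \<in> {b..c} - {b, c}"
    then have "vector_derivative \<gamma> (at t) = D t"
      using D by (auto intro!: vector_derivative_at regular_on_has_vector_derivative_interior[of b c])
    then show "speed M \<gamma> t = quad_norm (M (\<gamma> t)) (D t)"
      by (simp add: speed_def)
  qed simp
  with ab show ?case
    using snoc.hyps Henstock_Kurzweil_Integration.integrable_combine[of a b c] by simp
qed

lemma speed_affine:
  assumes "(\<gamma> has_vector_derivative vector_derivative \<gamma> (at (m * t + s))) (at (m * t + s))"
    and m: "m = 1 \<or> m = - 1"
  shows "speed M (\<lambda>t. \<gamma> (m * t + s)) t = speed M \<gamma> (m * t + s)"
proof -
  have "((\<lambda>t. m * t + s) has_vector_derivative m) (at t)"
    by (auto intro!: derivative_eq_intros)
  from vector_diff_chain_at[OF this assms(1)]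
  have "vector_derivative (\<lambda>t. \<gamma> (m * t + s)) (at t) = m *\<^sub>R vector_derivative \<gamma> (at (m * t + s))"
    by (intro vector_derivative_at) (simp add: o_def)
  then show ?thesis
    using m by (auto simp: speed_def)
qed

lemma curve_length_shift:
  assumes "piecewise_regular_on a b \<gamma>"
  shows "curve_length M (a - s, b - s, \<lambda>t. \<gamma> (t + s)) = curve_length M (a, b, \<gamma>)"
proof -
  obtain S where S: "finite S"
    "\<And>t. t \<in> {a..b} - S \<Longrightarrow> (\<gamma> has_vector_derivative vector_derivative \<gamma> (at t)) (at t)"
    using piecewise_regular_on_differentiable[OF assms] by blast
  have "integral {a - s..b - s} (speed M (\<lambda>t. \<gamma> (t + s))) =
      integral {a - s..b - s} (\<lambda>t. speed M \<gamma> (t + s))"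
  proof (rule integral_spike[of "(\<lambda>t. t - s) ` S"])
    show "negligible ((\<lambda>t. t - s) ` S)"
      using S by (simp add: negligible_finite)
    fix t assume t: "t \<in> {a - s..b - s} - (\<lambda>t. t - s) ` S"
    then have "t + s \<notin> S"
      by force
    with t show "speed M \<gamma> (t + s) = speed M (\<lambda>t. \<gamma> (t + s)) t"
      using speed_affine[of \<gamma> 1 t s M] S(2)[of "t + s"] by auto
  qed
  then show ?thesis
    by (simp add: curve_length_eq_integral_speed integral_shift_real_ivl)
qed

lemma curve_length_reflect:
  assumes "piecewise_regular_on a b \<gamma>"
  shows "curve_length M (s - b, s - a, \<lambda>t. \<gamma> (s - t)) = curve_length M (a, b, \<gamma>)"
proof -
  obtain S where S: "finite S"
    "\<And>t. t \<in> {a..b} - S \<Longrightarrow> (\<gamma> has_vector_derivative vector_derivative \<gamma> (at t)) (at t)"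
    using piecewise_regular_on_differentiable[OF assms] by blast
  have "integral {s - b..s - a} (speed M (\<lambda>t. \<gamma> (s - t))) =
      integral {s - b..s - a} (\<lambda>t. speed M \<gamma> (s - t))"
  proof (rule integral_spike[of "(\<lambda>t. s - t) ` S"])
    show "negligible ((\<lambda>t. s - t) ` S)"
      using S by (simp add: negligible_finite)
    fix t assume t: "t \<in> {s - b..s - a} - (\<lambda>t. s - t) ` S"
    then have "s - t \<notin> S"
      by force
    with t show "speed M \<gamma> (s - t) = speed M (\<lambda>t. \<gamma> (s - t)) t"
      using speed_affine[of \<gamma> "-1" t s M] S(2)[of "s - t"] by auto
  qed
  also have "\<dots> = integral {- b..- a} (\<lambda>t. speed M \<gamma> (- t))"
    using integral_shift_real_ivl[of "-b" "-s" "-a" "\<lambda>t. speed M \<gamma> (- t)"] by simp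
  also have "\<dots> = integral {a..b} (speed M \<gamma>)"
    by (rule Henstock_Kurzweil_Integration.integral_reflect_real)
  finally show ?thesis
    by (simp add: curve_length_eq_integral_speed)
qed

section \<open>The path metric of a domain with a metric tensor\<close>

text \<open>Positive definiteness is required on the whole space so that the length of every curve is
  nonnegative, also where a curve is not known to stay in \<open>X\<close>.\<close>
locale riemannian_domain =
  fixes X :: "(real^'n) set" and M :: "real^'n \<Rightarrow> real^'n^'n" and \<mu> :: real
  assumes open_X: "open X" and connected_X: "connected X"
    and pos_definite_M: "\<And>x. pos_definite (M x)"
    and uniformly_continuous_M: "uniformly_continuous_on X M"
    and mu_pos: "0 < \<mu>"
    and mu_le_M: "\<And>x. x \<in> X \<Longrightarrow> \<mu> *\<^sub>R mat 1 \<preceq>\<^sub>L M x"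
begin

lemma M_lower_bound:
  assumes "x \<in> X"
  shows "\<mu> * (norm v)\<^sup>2 \<le> v \<bullet> (M x *v v)"
proof -
  have "0 \<le> v \<bullet> ((M x - \<mu> *\<^sub>R mat 1) *v v)"
    using mu_le_M[OF assms] by (simp add: loewner_le_def pos_semidefinite_def)
  then show ?thesis
    by (simp add: matrix_vector_mult_diff_rdistrib inner_diff_right power2_norm_eq_inner
        scaleR_matrix_vector_assoc[symmetric])
qed

lemma speed_nonneg: "0 \<le> speed M \<gamma> t"
  by (simp add: speed_def pos_definite_M)

lemma speed_integrable_admissible:
  assumes "admissible_curve X a b \<gamma>"
  shows "speed M \<gamma> integrable_on {a..b}"
proof (rule speed_integrable)
  show "piecewise_regular_on a b \<gamma>"
    using assms by (simp add: admissible_curve_def)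
  show "continuous_on {a..b} (\<lambda>t. M (\<gamma> t))"
    using continuous_on_compose2[OF uniformly_continuous_imp_continuous[OF uniformly_continuous_M]] assms
    unfolding admissible_curve_def by blast
qed

lemma curve_length_nonneg: "0 \<le> curve_length M g"
proof (cases g)
  case (fields a b \<gamma>)
  show ?thesis
  proof (cases "speed M \<gamma> integrable_on {a..b}")
    case True
    then show ?thesis
      by (auto simp: fields curve_length_eq_integral_speed speed_nonneg intro: integral_nonneg)
  next
    case False
    then show ?thesis
      by (simp add: fields curve_length_eq_integral_speed not_integrable_integral)
  qed
qed

lemma curves_between_refl: "x \<in> X \<Longrightarrow> (0, 0, \<lambda>_. x) \<in> curves_between X x x"
  by (auto simp: curves_between_def admissible_curve_def piecewise_regular_on_refl)

lemma curves_between_reverse: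
  assumes "(a, b, \<gamma>) \<in> curves_between X x y"
  shows "(a, b, \<lambda>t. \<gamma> (a + b - t)) \<in> curves_between X y x"
proof -
  have g: "0 \<le> a" "a \<le> b" "\<gamma> ` {a..b} \<subseteq> X" "continuous_on {a..b} \<gamma>"
    "piecewise_regular_on a b \<gamma>" "\<gamma> a = x" "\<gamma> b = y"
    using assms by (auto simp: curves_between_def admissible_curve_def)
  have "continuous_on {a..b} (\<lambda>t. \<gamma> (a + b - t))"
    by (intro continuous_on_compose2[OF g(4)] continuous_intros) auto
  moreover have "piecewise_regular_on a b (\<lambda>t. \<gamma> (a + b - t))"
    using piecewise_regular_on_reflect[OF g(5), of "a + b"] by simp
  ultimately show ?thesis
    using g by (auto simp: curves_between_def admissible_curve_def image_subset_iff)
qed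

lemma curve_length_reverse:
  assumes "(a, b, \<gamma>) \<in> curves_between X x y"
  shows "curve_length M (a, b, \<lambda>t. \<gamma> (a + b - t)) = curve_length M (a, b, \<gamma>)"
  using assms curve_length_reflect[of a b \<gamma> M "a + b"]
  by (simp add: curves_between_def admissible_curve_def)

text \<open>The parameter intervals are assumed to be adjacent; \<open>curves_between_concat\<close> reduces the general
  case to this one by a translation.\<close>
lemma curves_between_join:
  assumes "(a, b, \<gamma>) \<in> curves_between X x y" and "(b, c, \<eta>) \<in> curves_between X y z"
  defines "\<zeta> \<equiv> \<lambda>t. if t \<le> b then \<gamma> t else \<eta> t"
  shows "(a, c, \<zeta>) \<in> curves_between X x z"
    and "curve_length M (a, c, \<zeta>) = curve_length M (a, b, \<gamma>) + curve_length M (b, c, \<eta>)"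
proof -
  have g: "0 \<le> a" "a \<le> b" "\<gamma> ` {a..b} \<subseteq> X" "continuous_on {a..b} \<gamma>"
    "piecewise_regular_on a b \<gamma>" "\<gamma> a = x" "\<gamma> b = y"
    using assms by (auto simp: curves_between_def admissible_curve_def)
  have h: "b \<le> c" "\<eta> ` {b..c} \<subseteq> X" "continuous_on {b..c} \<eta>"
    "piecewise_regular_on b c \<eta>" "\<eta> b = y" "\<eta> c = z"
    using assms by (auto simp: curves_between_def admissible_curve_def)
  have z1: "\<zeta> t = \<gamma> t" if "t \<le> b" for t
    using that by (simp add: \<zeta>_def)
  have z2: "\<zeta> t = \<eta> t" if "b \<le> t" for t
    using that g h by (auto simp: \<zeta>_def)
  have un: "{a..c} = {a..b} \<union> {b..c}"
    using g h by auto
  have "continuous_on {a..b} \<zeta>" "continuous_on {b..c} \<zeta>"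
    using g(4) h(3) z1 z2 by (auto intro: continuous_on_eq)
  then have "continuous_on {a..c} \<zeta>"
    unfolding un by (intro continuous_on_closed_Un) auto
  moreover have "piecewise_regular_on a c \<zeta>"
    by (rule piecewise_regular_on_trans[of a b])
      (auto intro: piecewise_regular_on_cong[OF g(5)] piecewise_regular_on_cong[OF h(4)] simp: z1 z2)
  moreover have "\<zeta> ` {a..c} \<subseteq> X"
    unfolding un using g(3) h(2) by (auto simp: z1 z2 image_Un image_subset_iff)
  ultimately have adm: "admissible_curve X a c \<zeta>"
    by (simp add: admissible_curve_def)
  then show "(a, c, \<zeta>) \<in> curves_between X x z"
    using g h by (auto simp: curves_between_def z1 z2)
  have "integral {a..c} (speed M \<zeta>) = integral {a..b} (speed M \<zeta>) + integral {b..c} (speed M \<zeta>)"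
    using g h by (simp add: Henstock_Kurzweil_Integration.integral_combine
        speed_integrable_admissible[OF adm])
  also have "integral {a..b} (speed M \<zeta>) = integral {a..b} (speed M \<gamma>)"
  proof (rule integral_spike[of "{b}"])
    fix t assume t: "t \<in> {a..b} - {b}"
    then have "\<forall>\<^sub>F u in nhds t. u \<in> {..<b}"
      by (intro eventually_nhds_in_open) auto
    then have "\<forall>\<^sub>F u in nhds t. u \<in> UNIV \<longrightarrow> \<gamma> u = \<zeta> u"
      by eventually_elim (simp add: z1)
    then have "vector_derivative \<gamma> (at t) = vector_derivative \<zeta> (at t)"
      by (rule vector_derivative_cong_eq) auto
    then show "speed M \<gamma> t = speed M \<zeta> t"
      using t by (simp add: speed_def z1)
  qed simp
  also have "integral {b..c} (speed M \<zeta>) = integral {b..c} (speed M \<eta>)"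
  proof (rule integral_spike[of "{b}"])
    fix t assume t: "t \<in> {b..c} - {b}"
    then have "\<forall>\<^sub>F u in nhds t. u \<in> {b<..}"
      by (intro eventually_nhds_in_open) auto
    then have "\<forall>\<^sub>F u in nhds t. u \<in> UNIV \<longrightarrow> \<eta> u = \<zeta> u"
      by eventually_elim (simp add: z2)
    then have "vector_derivative \<eta> (at t) = vector_derivative \<zeta> (at t)"
      by (rule vector_derivative_cong_eq) auto
    then show "speed M \<eta> t = speed M \<zeta> t"
      using t by (simp add: speed_def z2)
  qed simp
  finally show "curve_length M (a, c, \<zeta>) = curve_length M (a, b, \<gamma>) + curve_length M (b, c, \<eta>)"
    by (simp add: curve_length_eq_integral_speed)
qed

lemma curves_between_concat:
  assumes "g \<in> curves_between X x y" and "h \<in> curves_between X y z"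
  obtains k where "k \<in> curves_between X x z"
    and "curve_length M k = curve_length M g + curve_length M h"
proof -
  obtain a b \<gamma> where g: "g = (a, b, \<gamma>)"
    by (cases g)
  obtain c d \<eta> where h: "h = (c, d, \<eta>)"
    by (cases h)
  define s where "s = c - b"
  have ab: "0 \<le> a" "a \<le> b"
    using assms(1) by (auto simp: g curves_between_def)
  have eta: "c \<le> d" "\<eta> ` {c..d} \<subseteq> X" "continuous_on {c..d} \<eta>" "piecewise_regular_on c d \<eta>"
    "\<eta> c = y" "\<eta> d = z"
    using assms(2) by (auto simp: h curves_between_def admissible_curve_def)
  have "continuous_on {b..d - s} (\<lambda>t. \<eta> (t + s))"
    by (intro continuous_on_compose2[OF eta(3)] continuous_intros) (auto simp: s_def)
  moreover have "piecewise_regular_on b (d - s) (\<lambda>t. \<eta> (t + s))"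
    using piecewise_regular_on_shift[OF eta(4), of s] by (simp add: s_def)
  moreover have "(\<lambda>t. \<eta> (t + s)) ` {b..d - s} \<subseteq> X"
    using eta(2) by (force simp: s_def)
  ultimately have shifted: "(b, d - s, \<lambda>t. \<eta> (t + s)) \<in> curves_between X y z"
    using eta ab by (auto simp: curves_between_def admissible_curve_def s_def)
  have "curve_length M (b, d - s, \<lambda>t. \<eta> (t + s)) = curve_length M h"
    using curve_length_shift[OF eta(4), of M s] by (simp add: h s_def)
  then show thesis
    using curves_between_join[OF assms(1)[unfolded g] shifted] that by (simp add: g)
qed

lemma affine_path_in_segment:
  assumes "t \<in> {0..1}"
  shows "u + t *\<^sub>R (v - u) \<in> closed_segment u v"
proof -
  have "u + t *\<^sub>R (v - u) = (1 - t) *\<^sub>R u + t *\<^sub>R v"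
    by (simp add: scaleR_diff_left scaleR_diff_right)
  then show ?thesis
    unfolding in_segment(1) using assms by (intro exI[of _ t]) simp
qed

lemma segment_curve:
  assumes "closed_segment u v \<subseteq> X" and "u \<noteq> v"
  defines "\<gamma> \<equiv> \<lambda>t. u + t *\<^sub>R (v - u)"
  shows "(0, 1, \<gamma>) \<in> curves_between X u v"
    and "speed M \<gamma> t = quad_norm (M (\<gamma> t)) (v - u)"
proof -
  have der: "(\<gamma> has_vector_derivative (v - u)) (at t within S)" for t S
    unfolding \<gamma>_def by (auto intro!: derivative_eq_intros)
  have "regular_on {0..1} \<gamma>"
    unfolding regular_on_def using der assms(2) by (intro exI[of _ "\<lambda>_. v - u"]) auto
  moreover have "\<gamma> ` {0..1} \<subseteq> X"
    using assms(1) affine_path_in_segment by (fastforce simp: \<gamma>_def)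
  moreover have "continuous_on {0..1} \<gamma>"
    unfolding \<gamma>_def by (intro continuous_intros)
  ultimately show "(0, 1, \<gamma>) \<in> curves_between X u v"
    using regular_on_imp_piecewise[of 0 1 \<gamma>]
    by (simp add: curves_between_def admissible_curve_def \<gamma>_def)
  show "speed M \<gamma> t = quad_norm (M (\<gamma> t)) (v - u)"
    by (simp add: speed_def vector_derivative_at[OF der])
qed

text \<open>Being joined by an admissible curve is an equivalence relation whose classes are open, since a
  ball in \<open>X\<close> contains the segments from its centre.  Connectedness leaves only one class.\<close>
lemma curves_between_nonempty:
  assumes "x \<in> X" and "y \<in> X"
  shows "curves_between X x y \<noteq> {}"
proof (rule connected_equivalence_relation[OF connected_X assms])
  show "curves_between X y x \<noteq> {}" if "curves_between X x y \<noteq> {}" for x y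
    using that curves_between_reverse by (metis ex_in_conv prod_cases3)
  show "curves_between X x z \<noteq> {}"
    if "curves_between X x y \<noteq> {}" "curves_between X y z \<noteq> {}" for x y z
    using that curves_between_concat by (metis ex_in_conv)
  fix a assume a: "a \<in> X"
  then obtain e where e: "e > 0" "ball a e \<subseteq> X"
    using open_X open_contains_ball by blast
  have "curves_between X a x \<noteq> {}" if x: "x \<in> ball a e" for x
  proof (cases "x = a")
    case False
    have "closed_segment a x \<subseteq> ball a e"
      using x e by (intro closed_segment_subset) auto
    then show ?thesis
      using segment_curve(1)[of a x] False e by blast
  qed (use curves_between_refl[OF a] in blast)
  then show "\<exists>T. openin (top_of_set X) T \<and> a \<in> T \<and> (\<forall>x\<in>T. curves_between X a x \<noteq> {})"
    using e by (intro exI[of _ "ball a e"]) (auto simp: openin_open_eq[OF open_X])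
qed

lemma path_dist_le_curve_length:
  assumes "g \<in> curves_between X x y" and "x \<in> X" and "y \<in> X"
  shows "path_dist X M x y \<le> curve_length M g"
  using assms curve_length_nonneg
  by (auto simp: path_dist_def intro!: cINF_lower bdd_belowI[of _ 0])

lemma path_dist_greatest:
  assumes "x \<in> X" and "y \<in> X" and "\<And>g. g \<in> curves_between X x y \<Longrightarrow> C \<le> curve_length M g"
  shows "C \<le> path_dist X M x y"
  using assms curves_between_nonempty by (auto simp: path_dist_def intro!: cINF_greatest)

text \<open>The chord \<open>w\<close> is the integral of the velocity.  Pairing with \<open>A w\<close> turns this into a scalar
  identity for \<open>|w|\<^sup>2\<close> in the norm of \<open>A\<close>, and Cauchy--Schwarz for \<open>A\<close> bounds the integrand by \<open>|w|\<close>
  times the speed; dividing by \<open>|w|\<close> gives the claim.  It is used with \<open>A = \<mu> I\<close> to separate points and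
  with \<open>A = M (\<gamma> s)\<close> to compare short arcs with their chords.\<close>
lemma chord_le_arc:
  assumes adm: "admissible_curve X a b \<gamma>" and st: "a \<le> s" "s \<le> t" "t \<le> b"
    and A: "pos_definite A"
    and comp: "\<And>u v. u \<in> {s..t} \<Longrightarrow> quad_norm A v \<le> \<kappa> * quad_norm (M (\<gamma> u)) v"
  shows "quad_norm A (\<gamma> t - \<gamma> s) \<le> \<kappa> * integral {s..t} (speed M \<gamma>)"
proof -
  define w where "w = \<gamma> t - \<gamma> s"
  have sub: "{s..t} \<subseteq> {a..b}"
    using st by auto
  have int: "speed M \<gamma> integrable_on {s..t}"
    using integrable_on_subinterval[OF speed_integrable_admissible[OF adm] sub] .
  obtain S where S: "finite S"
    "\<And>t. t \<in> {a..b} - S \<Longrightarrow> (\<gamma> has_vector_derivative vector_derivative \<gamma> (at t)) (at t)"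
    using piecewise_regular_on_differentiable[of a b \<gamma>] adm unfolding admissible_curve_def by blast
  have "((\<lambda>u. vector_derivative \<gamma> (at u)) has_integral w) {s..t}"
    unfolding w_def
    using S st adm
    by (intro fundamental_theorem_of_calculus_interior_strong[of S])
      (auto simp: admissible_curve_def intro: continuous_on_subset)
  then have *: "((\<lambda>u. (A *v w) \<bullet> vector_derivative \<gamma> (at u)) has_integral (A *v w) \<bullet> w) {s..t}"
    using has_integral_linear[OF _ bounded_linear_inner_right] unfolding o_def by blast
  have "((\<lambda>u. quad_norm A w * (\<kappa> * speed M \<gamma> u)) has_integral
      quad_norm A w * (\<kappa> * integral {s..t} (speed M \<gamma>))) {s..t}"
    by (intro has_integral_mult_right integrable_integral int)
  with * have "(A *v w) \<bullet> w \<le> quad_norm A w * (\<kappa> * integral {s..t} (speed M \<gamma>))"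
  proof (rule has_integral_le)
    fix u assume u: "u \<in> {s..t}"
    have "(A *v w) \<bullet> vector_derivative \<gamma> (at u) = vector_derivative \<gamma> (at u) \<bullet> (A *v w)"
      by (rule inner_commute)
    also have "\<dots> \<le> quad_norm A (vector_derivative \<gamma> (at u)) * quad_norm A w"
      by (rule quad_norm_Cauchy_Schwarz[OF A])
    also have "\<dots> \<le> (\<kappa> * speed M \<gamma> u) * quad_norm A w"
      unfolding speed_def using A comp u by (intro mult_right_mono) auto
    finally show "(A *v w) \<bullet> vector_derivative \<gamma> (at u) \<le> quad_norm A w * (\<kappa> * speed M \<gamma> u)"
      by (simp add: mult.commute)
  qed
  then have le: "quad_norm A w * quad_norm A w \<le> quad_norm A w * (\<kappa> * integral {s..t} (speed M \<gamma>))"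
    by (simp add: quad_norm_square[OF A] inner_commute flip: power2_eq_square)
  show ?thesis
  proof (cases "quad_norm A w = 0")
    case True
    have "0 \<le> \<kappa> * speed M \<gamma> u" if "u \<in> {s..t}" for u
      using order_trans[OF quad_norm_nonneg[OF A] comp[OF that]] by (simp add: speed_def)
    then have "0 \<le> integral {s..t} (\<lambda>u. \<kappa> * speed M \<gamma> u)"
      using integrable_on_cmult_left[OF int, of \<kappa>] by (intro integral_nonneg) auto
    then show ?thesis
      using True by (simp add: w_def)
  next
    case False
    then have "quad_norm A w > 0"
      using quad_norm_nonneg[OF A, of w] by linarith
    then show ?thesis
      using le by (simp add: w_def)
  qed
qed

lemma norm_le_curve_length:
  assumes "(a, b, \<gamma>) \<in> curves_between X x y"
  shows "sqrt \<mu> * norm (y - x) \<le> curve_length M (a, b, \<gamma>)"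
proof -
  define A :: "real^'n^'n" where "A = \<mu> *\<^sub>R mat 1"
  have qA: "quad_norm A v = sqrt \<mu> * norm v" for v
    by (simp add: A_def quad_norm_def real_sqrt_mult norm_eq_sqrt_inner
        scaleR_matrix_vector_assoc[symmetric])
  have "pos_definite A"
    using mu_pos by (auto simp: A_def pos_definite_def transpose_scalar
        scaleR_matrix_vector_assoc[symmetric])
  moreover have "quad_norm A v \<le> 1 * quad_norm (M (\<gamma> u)) v" if "u \<in> {a..b}" for u v
  proof -
    have "\<gamma> u \<in> X"
      using assms that by (auto simp: curves_between_def admissible_curve_def)
    from M_lower_bound[OF this, of v] have "sqrt (\<mu> * (norm v)\<^sup>2) \<le> quad_norm (M (\<gamma> u)) v"
      by (simp add: quad_norm_def)
    then show ?thesis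
      by (simp add: qA real_sqrt_mult)
  qed
  ultimately show ?thesis
    using chord_le_arc[of a b \<gamma> a b A 1] assms
    by (auto simp: qA curve_length_eq_integral_speed curves_between_def)
qed

lemma path_dist_refl:
  assumes "x \<in> X"
  shows "path_dist X M x x = 0"
proof (rule antisym)
  show "path_dist X M x x \<le> 0"
    using path_dist_le_curve_length[OF curves_between_refl] assms
    by (simp add: curve_length_eq_integral_speed)
  show "0 \<le> path_dist X M x x"
    using assms by (intro path_dist_greatest curve_length_nonneg)
qed

lemma path_dist_triangle:
  assumes "x \<in> X" and "y \<in> X" and "z \<in> X"
  shows "path_dist X M x z \<le> path_dist X M x y + path_dist X M y z"
proof -
  have "path_dist X M x z - curve_length M h \<le> curve_length M g"
    if g: "g \<in> curves_between X x y" and h: "h \<in> curves_between X y z" for g h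
  proof -
    obtain k where "k \<in> curves_between X x z" "curve_length M k = curve_length M g + curve_length M h"
      using curves_between_concat[OF g h] .
    then show ?thesis
      using path_dist_le_curve_length[of k x z] assms by simp
  qed
  then have "path_dist X M x z - curve_length M h \<le> path_dist X M x y"
    if "h \<in> curves_between X y z" for h
    using that assms by (intro path_dist_greatest) auto
  then have "path_dist X M x z - path_dist X M x y \<le> path_dist X M y z"
    using assms by (intro path_dist_greatest) (auto simp: algebra_simps)
  then show ?thesis
    by simp
qed

theorem Metric_space_path_dist: "Metric_space X (path_dist X M)"
proof
  show "0 \<le> path_dist X M x y" for x y
    using path_dist_greatest[of x y 0] curve_length_nonneg by (cases "x \<in> X \<and> y \<in> X") (auto simp: path_dist_def)
  have le: "path_dist X M x y \<le> path_dist X M y x" if "x \<in> X" "y \<in> X" for x y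
  proof (rule path_dist_greatest)
    fix g assume g: "g \<in> curves_between X y x"
    obtain a b \<gamma> where "g = (a, b, \<gamma>)"
      by (cases g)
    with g show "path_dist X M x y \<le> curve_length M g"
      using path_dist_le_curve_length[OF curves_between_reverse that] curve_length_reverse by metis
  qed (use that in auto)
  show "path_dist X M x y = path_dist X M y x" for x y
    using le[of x y] le[of y x] by (cases "x \<in> X \<and> y \<in> X") (auto simp: path_dist_def)
  show "path_dist X M x y = 0 \<longleftrightarrow> x = y" if "x \<in> X" "y \<in> X" for x y
  proof
    have "sqrt \<mu> * norm (y - x) \<le> path_dist X M x y"
      using that norm_le_curve_length by (intro path_dist_greatest) auto
    then show "path_dist X M x y = 0 \<Longrightarrow> x = y"
      using mu_pos by (auto simp: mult_le_0_iff)
  qed (use path_dist_refl that in auto)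
qed (rule path_dist_triangle)

text \<open>If \<open>M x\<close> and \<open>M y\<close> differ by at most \<open>(\<kappa>\<^sup>2 - 1) \<mu>\<close>, their quadratic forms differ by at most
  \<open>(\<kappa>\<^sup>2 - 1) \<mu> |v|\<^sup>2\<close>, and the lower bound \<open>\<mu> I \<preceq> M y\<close> absorbs this error into the form of \<open>M y\<close>.
  Without that bound \<open>M\<close> could degenerate towards the boundary of \<open>X\<close>, where a small error is no longer a small
  relative error.\<close>
lemma uniform_distortion:
  assumes "1 < \<kappa>"
  obtains r where "r > 0"
    and "\<And>x y v. \<lbrakk>x \<in> X; y \<in> X; dist x y < r\<rbrakk> \<Longrightarrow> quad_norm (M x) v \<le> \<kappa> * quad_norm (M y) v"
proof -
  have "1 < \<kappa>\<^sup>2"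
    using assms by (simp add: one_less_power)
  then have "0 < (\<kappa>\<^sup>2 - 1) * \<mu>"
    using mu_pos by simp
  then obtain r where r: "r > 0"
    "\<And>x y. \<lbrakk>x \<in> X; y \<in> X; dist x y < r\<rbrakk> \<Longrightarrow> dist (M x) (M y) < (\<kappa>\<^sup>2 - 1) * \<mu>"
    using uniformly_continuous_M unfolding uniformly_continuous_on_def by (metis dist_commute)
  have "quad_norm (M x) v \<le> \<kappa> * quad_norm (M y) v" if "x \<in> X" "y \<in> X" "dist x y < r" for x y v
  proof -
    have "v \<bullet> ((M x - M y) *v v) \<le> norm v * (norm (M x - M y) * norm v)"
      by (meson norm_cauchy_schwarz norm_matrix_vector_mult_le mult_left_mono norm_ge_zero order_trans)
    also have "\<dots> = norm (M x - M y) * (norm v)\<^sup>2"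
      by (simp add: power2_eq_square)
    also have "\<dots> \<le> ((\<kappa>\<^sup>2 - 1) * \<mu>) * (norm v)\<^sup>2"
      using r(2)[OF that] by (intro mult_right_mono) (auto simp: dist_norm)
    also have "\<dots> \<le> (\<kappa>\<^sup>2 - 1) * (v \<bullet> (M y *v v))"
      using M_lower_bound[OF that(2), of v] \<open>1 < \<kappa>\<^sup>2\<close> by (simp add: mult.assoc)
    finally have "v \<bullet> (M x *v v) \<le> \<kappa>\<^sup>2 * (v \<bullet> (M y *v v))"
      by (simp add: matrix_vector_mult_diff_rdistrib inner_diff_right algebra_simps)
    then have "sqrt (v \<bullet> (M x *v v)) \<le> sqrt (\<kappa>\<^sup>2 * (v \<bullet> (M y *v v)))"
      by simp
    then show ?thesis
      using assms by (simp add: quad_norm_def real_sqrt_mult)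
  qed
  with r(1) show thesis
    by (rule that)
qed

lemma path_dist_le_segment:
  assumes seg: "closed_segment u v \<subseteq> X"
    and comp: "\<And>w. w \<in> closed_segment u v \<Longrightarrow> quad_norm (M w) (v - u) \<le> \<kappa> * quad_norm (M u) (v - u)"
  shows "path_dist X M u v \<le> \<kappa> * quad_norm (M u) (v - u)"
proof (cases "u = v")
  (* A constant curve on [0, 1] has velocity 0 and is not regular, so the degenerate segment is
     not an admissible curve. *)
  case True
  then show ?thesis
    using seg path_dist_refl by auto
next
  case False
  define \<gamma> where "\<gamma> = (\<lambda>t::real. u + t *\<^sub>R (v - u))"
  have curve: "(0, 1, \<gamma>) \<in> curves_between X u v"
    unfolding \<gamma>_def by (rule segment_curve(1)[OF seg False])
  have speed: "speed M \<gamma> t = quad_norm (M (\<gamma> t)) (v - u)" for t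
    unfolding \<gamma>_def by (rule segment_curve(2)[OF seg False])
  have "u \<in> X" "v \<in> X"
    using seg by auto
  then have "path_dist X M u v \<le> integral {0..1} (speed M \<gamma>)"
    using path_dist_le_curve_length[OF curve] by (simp add: curve_length_eq_integral_speed)
  also have "\<dots> \<le> integral {0..1::real} (\<lambda>t. \<kappa> * quad_norm (M u) (v - u))"
  proof (rule integral_le)
    show "speed M \<gamma> integrable_on {0..1}"
      using curve by (intro speed_integrable_admissible) (simp add: curves_between_def)
    fix t :: real assume "t \<in> {0..1}"
    then have "\<gamma> t \<in> closed_segment u v"
      unfolding \<gamma>_def by (rule affine_path_in_segment)
    then show "speed M \<gamma> t \<le> \<kappa> * quad_norm (M u) (v - u)"
      unfolding speed by (rule comp)
  qed auto
  finally show ?thesis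
    by simp
qed


section \<open>Contraction\<close>

text \<open>The polygon through the images of sufficiently many points of the curve replaces the image
  curve, which need not be admissible.  One factor \<open>\<kappa>\<close> pays for measuring a whole segment at its
  starting point, the other for comparing a chord with its arc.\<close>
lemma path_dist_image_le_curve_length:
  assumes f: "continuous_on X f" "f ` X \<subseteq> X" and "0 \<le> \<rho>" and \<kappa>: "1 < \<kappa>" and "0 < \<epsilon>"
    and local_contr: "\<And>x y. \<lbrakk>x \<in> X; y \<in> X; dist x y < \<epsilon>\<rbrakk> \<Longrightarrow>
      quad_norm (M (f x)) (f y - f x) \<le> \<rho> * quad_norm (M x) (y - x)"
    and curve: "(a, b, \<gamma>) \<in> curves_between X x y"
  shows "path_dist X M (f x) (f y) \<le> \<rho> * \<kappa>\<^sup>2 * curve_length M (a, b, \<gamma>)"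
proof -
  have g: "a \<le> b" "admissible_curve X a b \<gamma>" "\<gamma> ` {a..b} \<subseteq> X" "continuous_on {a..b} \<gamma>"
    "\<gamma> a = x" "\<gamma> b = y"
    using curve by (auto simp: curves_between_def admissible_curve_def)
  have gX: "\<gamma> t \<in> X" "f (\<gamma> t) \<in> X" if "t \<in> {a..b}" for t
    using g(3) f(2) that by blast+
  have contfg: "continuous_on {a..b} (\<lambda>t. f (\<gamma> t))"
    by (rule continuous_on_compose2[OF f(1) g(4,3)])
  obtain r where r: "r > 0"
    "\<And>x y v. \<lbrakk>x \<in> X; y \<in> X; dist x y < r\<rbrakk> \<Longrightarrow> quad_norm (M x) v \<le> \<kappa> * quad_norm (M y) v"
    using uniform_distortion[OF \<kappa>] by blast
  (* Segments shorter than e that start on the image curve stay in X. *)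
  obtain e where e: "e > 0" "(\<Union>p\<in>(\<lambda>t. f (\<gamma> t)) ` {a..b}. ball p e) \<subseteq> X"
    by (rule compact_subset_open_imp_ball_epsilon_subset[of "(\<lambda>t. f (\<gamma> t)) ` {a..b}" X])
      (auto intro: compact_continuous_image contfg open_X gX)
  obtain d1 where d1: "d1 > 0"
    "\<And>s t. \<lbrakk>s \<in> {a..b}; t \<in> {a..b}; dist s t < d1\<rbrakk> \<Longrightarrow> dist (\<gamma> s) (\<gamma> t) < min r \<epsilon>"
    using compact_uniformly_continuous[OF g(4)] r(1) \<open>0 < \<epsilon>\<close> unfolding uniformly_continuous_on_def
    by (metis compact_Icc min_less_iff_conj dist_commute)
  obtain d2 where d2: "d2 > 0"
    "\<And>s t. \<lbrakk>s \<in> {a..b}; t \<in> {a..b}; dist s t < d2\<rbrakk> \<Longrightarrow> dist (f (\<gamma> s)) (f (\<gamma> t)) < min r e"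
    using compact_uniformly_continuous[OF contfg] r(1) e(1) unfolding uniformly_continuous_on_def
    by (metis compact_Icc min_less_iff_conj dist_commute)
  define L where "L = (\<lambda>s t. integral {s..t} (speed M \<gamma>))"
  have step: "path_dist X M (f (\<gamma> s)) (f (\<gamma> t)) \<le> \<rho> * \<kappa>\<^sup>2 * L s t"
    if st: "a \<le> s" "s \<le> t" "t \<le> b" and close: "t - s < min d1 d2" for s t
  proof -
    have in_ab: "s \<in> {a..b}" "t \<in> {a..b}"
      using st by auto
    have sub: "closed_segment (f (\<gamma> s)) (f (\<gamma> t)) \<subseteq> ball (f (\<gamma> s)) (min r e)"
      using d2(2)[OF in_ab] close st r(1) e(1)
      by (intro closed_segment_subset) (auto simp: dist_real_def)
    have seg: "closed_segment (f (\<gamma> s)) (f (\<gamma> t)) \<subseteq> X"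
      using sub e(2) in_ab by fastforce
    have "path_dist X M (f (\<gamma> s)) (f (\<gamma> t)) \<le> \<kappa> * quad_norm (M (f (\<gamma> s))) (f (\<gamma> t) - f (\<gamma> s))"
    proof (rule path_dist_le_segment[OF seg])
      fix w assume "w \<in> closed_segment (f (\<gamma> s)) (f (\<gamma> t))"
      then show "quad_norm (M w) (f (\<gamma> t) - f (\<gamma> s)) \<le> \<kappa> * quad_norm (M (f (\<gamma> s))) (f (\<gamma> t) - f (\<gamma> s))"
        using sub seg gX(2)[OF in_ab(1)] by (intro r(2)) (auto simp: dist_commute)
    qed
    also have "\<dots> \<le> \<kappa> * (\<rho> * quad_norm (M (\<gamma> s)) (\<gamma> t - \<gamma> s))"
      using d1(2)[OF in_ab] close st \<kappa> gX in_ab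
      by (intro mult_left_mono local_contr) (auto simp: dist_real_def)
    also have "\<dots> \<le> \<kappa> * (\<rho> * (\<kappa> * L s t))"
    proof -
      have "quad_norm (M (\<gamma> s)) v \<le> \<kappa> * quad_norm (M (\<gamma> u)) v" if "u \<in> {s..t}" for u v
        using that st close d1(2)[of s u] by (intro r(2) gX) (auto simp: dist_real_def)
      from chord_le_arc[OF g(2) st pos_definite_M this]
      show ?thesis
        unfolding L_def using \<kappa> \<open>0 \<le> \<rho>\<close> by (intro mult_left_mono) auto
    qed
    finally show ?thesis
      by (simp add: power2_eq_square mult_ac)
  qed
  have "0 < min d1 d2"
    using d1 d2 by simp
  then obtain N :: nat where N: "b - a < real N * min d1 d2"
    using reals_Archimedean3 by blast
  then have "0 < N"
    using g(1) by (cases N) auto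
  define h where "h = (b - a) / real N"
  have h: "0 \<le> h" "real N * h = b - a"
    using g(1) \<open>0 < N\<close> by (auto simp: h_def)
  then have "real N * h < real N * min d1 d2"
    using N by simp
  then have h_less: "h < min d1 d2"
    by (rule mult_left_less_imp_less) simp
  (* The triangle inequality adds up the arcs of the partition of [a, b] into N equal parts. *)
  have "path_dist X M (f x) (f (\<gamma> (a + real i * h))) \<le> \<rho> * \<kappa>\<^sup>2 * L a (a + real i * h)" if "i \<le> N" for i
    using that
  proof (induction i)
    case 0
    then show ?case
      using path_dist_refl gX(2)[of a] g by (simp add: L_def)
  next
    case (Suc i)
    define s where "s = a + real i * h"
    define t where "t = a + real (Suc i) * h"
    have "real (Suc i) * h \<le> real N * h"
      using Suc.prems h(1) by (intro mult_right_mono) auto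
    then have st: "a \<le> s" "s \<le> t" "t \<le> b" "t - s < min d1 d2"
      using h h_less by (auto simp: s_def t_def algebra_simps)
    have in_ab: "a \<in> {a..b}" "s \<in> {a..b}" "t \<in> {a..b}"
      using st by auto
    have "L a t = L a s + L s t"
      unfolding L_def
      using st integrable_on_subinterval[OF speed_integrable_admissible[OF g(2)], of a t]
      by (simp add: Henstock_Kurzweil_Integration.integral_combine)
    moreover have "path_dist X M (f x) (f (\<gamma> s)) \<le> \<rho> * \<kappa>\<^sup>2 * L a s"
      using Suc unfolding s_def by simp
    moreover have "path_dist X M (f x) (f (\<gamma> t)) \<le>
        path_dist X M (f x) (f (\<gamma> s)) + path_dist X M (f (\<gamma> s)) (f (\<gamma> t))"
      using gX(2) in_ab g(5) by (intro path_dist_triangle) auto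
    ultimately have "path_dist X M (f x) (f (\<gamma> t)) \<le> \<rho> * \<kappa>\<^sup>2 * L a t"
      using step[OF st] by (simp add: distrib_left)
    then show ?case
      unfolding t_def .
  qed
  from this[of N] show ?thesis
    using g h(2) by (simp add: L_def curve_length_eq_integral_speed)
qed

lemma contracting_of_local_contraction:
  assumes f: "continuous_on X f" "forward_invariant f X" and \<rho>: "0 < \<rho>" "\<rho> < \<rho>'" "\<rho>' < 1"
    and \<epsilon>: "0 < \<epsilon>"
    and local_contr: "\<And>x y. \<lbrakk>x \<in> X; y \<in> X; dist x y < \<epsilon>\<rbrakk> \<Longrightarrow>
      quad_norm (M (f x)) (f y - f x) \<le> \<rho> * quad_norm (M x) (y - x)"
  shows "contracting f X (path_dist X M) \<rho>'"
proof -
  have fX: "f ` X \<subseteq> X"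
    using f(2) by (simp add: forward_invariant_def)
  define \<kappa> where "\<kappa> = sqrt (\<rho>' / \<rho>)"
  have \<kappa>: "1 < \<kappa>" "\<rho> * \<kappa>\<^sup>2 = \<rho>'"
    using \<rho> by (auto simp: \<kappa>_def)
  have "path_dist X M (f x) (f y) \<le> \<rho>' * path_dist X M x y" if xy: "x \<in> X" "y \<in> X" for x y
  proof -
    have "path_dist X M (f x) (f y) / \<rho>' \<le> path_dist X M x y"
    proof (rule path_dist_greatest[OF xy])
      fix g assume g: "g \<in> curves_between X x y"
      obtain a b \<gamma> where "g = (a, b, \<gamma>)"
        by (cases g)
      with g path_dist_image_le_curve_length[OF f(1) fX less_imp_le[OF \<rho>(1)] \<kappa>(1) \<epsilon> local_contr]
      have "path_dist X M (f x) (f y) \<le> \<rho>' * curve_length M g"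
        unfolding \<kappa>(2) by blast
      then show "path_dist X M (f x) (f y) / \<rho>' \<le> curve_length M g"
        using \<rho> by (simp add: divide_simps mult.commute)
    qed
    then show ?thesis
      using \<rho> by (simp add: divide_simps mult.commute)
  qed
  then show ?thesis
    using f(2) \<rho> Metric_space_path_dist by (auto simp: contracting_def)
qed

end

text \<open>The defect is a difference of two squares of norms, so its sign compares the norms.\<close>
lemma contraction_defect_nonpos_iff:
  assumes "pos_definite (M x)" and "pos_definite (M (f x))" and "0 \<le> \<rho>"
  shows "contraction_defect f M \<rho> x \<delta> \<le> 0 \<longleftrightarrow>
    quad_norm (M (f x)) (f (x + \<delta>) - f x) \<le> \<rho> * quad_norm (M x) \<delta>"
proof -
  have "contraction_defect f M \<rho> x \<delta> =
      (quad_norm (M (f x)) (f (x + \<delta>) - f x))\<^sup>2 - (\<rho> * quad_norm (M x) \<delta>)\<^sup>2"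
    using quad_norm_square[OF assms(2), of "f x - f (x + \<delta>)"] quad_norm_square[OF assms(1), of \<delta>]
      quad_norm_minus[of "M (f x)" "f (x + \<delta>) - f x"]
    by (simp add: contraction_defect_def power_mult_distrib)
  then show ?thesis
    using assms by (simp add: power_mono_iff)
qed

theorem theorem6:
  fixes f :: "real^'n \<Rightarrow> real^'n"
    and B X :: "(real^'n) set"
    and V :: "real^'n \<Rightarrow> real"
    and M :: "real^'n \<Rightarrow> real^'n^'n"
    and c \<mu> \<rho> \<epsilon> :: real
  defines "X \<equiv> {x. V x < c} \<inter> B"
  assumes "continuous_on UNIV f"
    and "is_box B"
    and "open X"
    and "connected X"
    and "forward_invariant f X"
    and "0 < \<mu>"
    and "\<forall>x. pos_definite (M x)"
    and "uniformly_continuous_on X M"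
    and "\<forall>x\<in>X. \<mu> *\<^sub>R mat 1 \<preceq>\<^sub>L M x"
    and "0 < \<rho>" and "\<rho> < 1"
    and "0 < \<epsilon>"
    and "\<forall>(x, \<delta>) \<in> B \<times> inf_ball \<epsilon>.
           - contraction_defect f M \<rho> x \<delta> \<ge> 0 \<or> x + \<delta> \<notin> B \<or> V x \<ge> c \<or> V (x + \<delta>) \<ge> c"
  shows "Metric_space X (path_dist X M) \<and>
         (\<forall>\<rho>'\<in>{\<rho><..<1}. contracting f X (path_dist X M) \<rho>')"
proof -
  interpret riemannian_domain X M \<mu>
    using assms by unfold_locales auto
  have "quad_norm (M (f x)) (f y - f x) \<le> \<rho> * quad_norm (M x) (y - x)"
    if "x \<in> X" "y \<in> X" "dist x y < \<epsilon>" for x y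
  proof -
    have "infnorm (y - x) \<le> \<epsilon>"
      using infnorm_le_norm[of "y - x"] that(3) by (simp add: dist_norm norm_minus_commute)
    then have "contraction_defect f M \<rho> x (y - x) \<le> 0"
      using assms(14) that(1,2) unfolding X_def inf_ball_def by fastforce
    then show ?thesis
      using contraction_defect_nonpos_iff[of M x f \<rho> "y - x"] pos_definite_M \<open>0 < \<rho>\<close> by simp
  qed
  moreover have "continuous_on X f"
    using assms(2) continuous_on_subset by blast
  ultimately show ?thesis
    using assms(6,11,13) Metric_space_path_dist contracting_of_local_contraction[of f \<rho> _ \<epsilon>] by auto
qed

end
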